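(* Let $d\ge 2$ be a fixed integer and, for each $i\in\mathbb N$, let $2\le d_i\le d$ and let $A_i$ be a $d_i\times d_i$ matrix acting on $\mathbb R^{d_i}$. Let $\{A_i\}_{i\in\mathbb N}$ be a family of uniformly normalizable matrices, and suppose the real parts of the eigenvalues of the matrices $A_1,A_2,\dots$ are negative. Let $\rho,\sigma>0$ and suppose that $\rho>\sigma$. Consider the differential game $$\dot x_i=A_ix_i+u_i-v_i,\qquad x_i(0)=x_{i0}\in\mathbb R^{d_i},\qquad i=1,2,\dots,$$ with $x_0=(x_{10},x_{20},\dots)\in\ell^2$, in which $u=(u_1,u_2,\dots)$ is the control of the pursuer and $v=(v_1,v_2,\dots)$ is the control of the evader. Then, for any admissible control $v$ of the evader, there exist a strategy $u$ of the pursuer and $\vartheta_1>0$ such that the solution $x(\cdot)$ of the game system satisfies $x(\tau)=0$ for some $0\le\tau\le\vartheta_1$, i.e., the game can be completed within time $\vartheta_1$.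
   Context: $\ell^2$ denotes the Hilbert space of sequences $x=(x_1,x_2,\dots)$ with $x_i\in\mathbb R^{d_i}$ and $\|x\|^2=\sum_{i=1}^\infty\|x_i\|^2<\infty$, where $\|x_i\|$ is the Euclidean norm on $\mathbb R^{d_i}$. Uniformly normalizable: there exist a family $\{P_i\}_{i\in\mathbb N}$ of non-singular matrices and a constant $C\ge 1$ such that $\|P_i\|\cdot\|P_i^{-1}\|\le C$ and $P_iA_iP_i^{-1}$ is a matrix in Jordan normal form for all $i\in\mathbb N$. $[0,T]$, $T>0$, denotes the time interval on which controls are defined. For $\theta>0$, $B(\theta)$ is the set of all functions $w=(w_1,w_2,\dots):[0,T]\to\ell^2$ with measurable coordinates $w_i:[0,T]\to\mathbb R^{d_i}$ such that $\sum_{i=1}^\infty\int_0^T\|w_i(s)\|^2\,ds\le\theta^2$. An admissible control of the pursuer is an element of $B(\rho)$; an admissible control of the evader is an element of $B(\sigma)$. A strategy of the pursuer is a function $u:[0,T]\times\ell^2\to\ell^2$ with coordinates $u_k(t)=v_k(t)+\omega_k(t)$, where $\omega=(\omega_1,\omega_2,\dots)\in B(\rho-\sigma)$, which is an admissible control of the pursuer for every admissible control $v$ of the evader. The solution corresponding to controls $u(\cdot),v(\cdot)$ is the $\ell^2$-valued function $x=(x_1,x_2,\dots)$ with $x_i(t)=e^{tA_i}x_{i0}+\int_0^te^{(t-s)A_i}(u_i(s)-v_i(s))\,ds$.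
   Formalization: The control interval [0,T] is taken sufficiently long: the claim is proved for all T at least some T0 > 0 depending on the data but not on v, since for a fixed small T a large initial state x0 cannot be steered to 0. *)

theory Defs
  imports
    "HOL-Analysis.Analysis"
    "Jordan_Normal_Form.Jordan_Normal_Form"
begin

unbundle no vec_syntax
hide_const (open) Finite_Cartesian_Product.vec Finite_Cartesian_Product.mat

text \<open>
  The dimensions \<open>n i\<close> vary with \<open>i\<close>, so the elements of the \<open>i\<close>-th coordinate space
  are vectors in \<open>carrier_vec (n i)\<close>. Sequences are indexed from \<open>0\<close>.
\<close>

definition enorm :: "'a::real_normed_field vec \<Rightarrow> real" where
  "enorm z = L2_set (\<lambda>k. norm (z $ k)) {..<dim_vec z}"

definition op_norm :: "'a::real_normed_field mat \<Rightarrow> real" where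
  "op_norm M = (SUP z \<in> {z \<in> carrier_vec (dim_col M). enorm z \<le> 1}. enorm (M *\<^sub>v z))"

definition mat_exp :: "real mat \<Rightarrow> real mat" where
  "mat_exp M = mat (dim_row M) (dim_row M) (\<lambda>(j, k). \<Sum>m. (M ^\<^sub>m m) $$ (j, k) / fact m)"

definition ell2 :: "(nat \<Rightarrow> nat) \<Rightarrow> (nat \<Rightarrow> real vec) set" where
  "ell2 n = {x. (\<forall>i. x i \<in> carrier_vec (n i)) \<and> summable (\<lambda>i. (enorm (x i))\<^sup>2)}"

text \<open>
  A real matrix may have non-real eigenvalues, so the Jordan normal form and the
  transformations \<open>P i\<close> are taken over the complex numbers. The library predicate
  \<open>similar_mat_wit J B P Q\<close> says that \<open>Q\<close> is the inverse of \<open>P\<close> and \<open>J = P * B * Q\<close>;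
  blocks of size \<open>0\<close> are excluded as in \<open>jordan_nf\<close>. The family \<open>Q\<close> is the family of the
  inverses of the \<open>P i\<close>.
\<close>

definition uniformly_normalizable :: "(nat \<Rightarrow> real mat) \<Rightarrow> bool" where
  "uniformly_normalizable A \<longleftrightarrow>
    (\<exists>(P :: nat \<Rightarrow> complex mat) (Q :: nat \<Rightarrow> complex mat) (C :: real). C \<ge> 1 \<and>
      (\<forall>i. op_norm (P i) * op_norm (Q i) \<le> C \<and>
        (\<exists>n_as. 0 \<notin> fst ` set n_as \<and>
          similar_mat_wit (jordan_matrix n_as) (map_mat complex_of_real (A i)) (P i) (Q i))))"

text \<open>
  The set \<open>B(\<theta>)\<close> of controls on \<open>[0,T]\<close>; only the values of \<open>w\<close> on \<open>[0,T]\<close> matter.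
  The energy is computed in the extended non-negative reals, so that the bound includes its
  finiteness.
\<close>

definition controls :: "(nat \<Rightarrow> nat) \<Rightarrow> real \<Rightarrow> real \<Rightarrow> (real \<Rightarrow> nat \<Rightarrow> real vec) set" where
  "controls n T \<theta> = {w.
    (\<forall>t\<in>{0..T}. w t \<in> ell2 n) \<and>
    (\<forall>i. \<forall>k<n i. (\<lambda>t. w t i $ k) \<in> borel_measurable (lebesgue_on {0..T})) \<and>
    (\<Sum>i. \<integral>\<^sup>+ s. ennreal ((enorm (w s i))\<^sup>2) \<partial>lebesgue_on {0..T}) \<le> ennreal (\<theta>\<^sup>2)}"

text \<open>
  A strategy is a function of the time and of the current value of the evader's control.
\<close>

definition pursuer_strategy ::
    "(nat \<Rightarrow> nat) \<Rightarrow> real \<Rightarrow> real \<Rightarrow> real \<Rightarrow> (real \<Rightarrow> (nat \<Rightarrow> real vec) \<Rightarrow> nat \<Rightarrow> real vec) \<Rightarrow> bool" where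
  "pursuer_strategy n T \<rho> \<sigma> U \<longleftrightarrow>
    (\<forall>t\<in>{0..T}. \<forall>y\<in>ell2 n. U t y \<in> ell2 n) \<and>
    (\<exists>\<omega>\<in>controls n T (\<rho> - \<sigma>). \<forall>t\<in>{0..T}. \<forall>y\<in>ell2 n. \<forall>k. U t y k = y k + \<omega> t k) \<and>
    (\<forall>v\<in>controls n T \<sigma>. (\<lambda>t. U t (v t)) \<in> controls n T \<rho>)"

definition is_solution ::
    "(nat \<Rightarrow> nat) \<Rightarrow> (nat \<Rightarrow> real mat) \<Rightarrow> real \<Rightarrow> (nat \<Rightarrow> real vec) \<Rightarrow>
     (real \<Rightarrow> nat \<Rightarrow> real vec) \<Rightarrow> (real \<Rightarrow> nat \<Rightarrow> real vec) \<Rightarrow> (real \<Rightarrow> nat \<Rightarrow> real vec) \<Rightarrow> bool" where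
  "is_solution n A T x0 u v x \<longleftrightarrow>
    (\<forall>t\<in>{0..T}. x t \<in> ell2 n \<and>
      (\<forall>i. x t i = mat_exp (t \<cdot>\<^sub>m A i) *\<^sub>v x0 i +
        vec (n i) (\<lambda>k. \<integral> s. (mat_exp ((t - s) \<cdot>\<^sub>m A i) *\<^sub>v (u s i - v s i)) $ k
          \<partial>lebesgue_on {0..t})))"

end

theory Submission
  imports Defs
begin

text \<open>
  The pursuer copies the evader and adds \<open>\<omega>\<^sub>i(s) = - e\<^bsup>sA\<^sub>i\<^esup> x\<^sub>i\<^sub>0 / \<theta>\<^sub>i\<close> on \<open>[0, \<theta>\<^sub>i]\<close>, so that
  \<open>x\<^sub>i(t) = (1 - min t \<theta>\<^sub>i / \<theta>\<^sub>i) e\<^bsup>tA\<^sub>i\<^esup> x\<^sub>i\<^sub>0\<close>; no Gramian is needed. In Jordan coordinates the entries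
  of \<open>e\<^bsup>tA\<^sub>i\<^esup>\<close> are \<open>t\<^sup>p/p! e\<^bsup>t\<lambda>\<^esup>\<close> with \<open>Re \<lambda> < 0\<close>. On \<open>[0,1]\<close> they are at most \<open>1\<close>, which bounds
  the flow uniformly in \<open>i\<close>, and for fixed \<open>i\<close> they are bounded on \<open>[0,\<infinity>)\<close>. There is no bound
  uniform in both, because the spectra may approach the imaginary axis. Therefore \<open>\<theta>\<^sub>i = 1\<close> for all
  but finitely many \<open>i\<close>, the energy of these components being a tail of a multiple of \<open>\<parallel>x\<^sub>0\<parallel>\<^sup>2\<close>,
  and \<open>\<theta>\<^sub>i = \<Theta>\<close> for the others, whose energy is \<open>O(1/\<Theta>)\<close>.
\<close>

section \<open>Matrix exponentials\<close>

lemma pow_mat_Suc_index: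
  fixes A :: "'a::semiring_1 mat"
  assumes "A \<in> carrier_mat n n" "j < n" "k < n"
  shows "(A ^\<^sub>m Suc m) $$ (j, k) = (\<Sum>l<n. (A ^\<^sub>m m) $$ (j, l) * A $$ (l, k))"
  using assms by (auto simp: scalar_prod_def atLeast0LessThan intro!: sum.cong)

lemma mult_mat_index:
  assumes "A \<in> carrier_mat n m" "B \<in> carrier_mat m r" "j < n" "k < r"
  shows "(A * B) $$ (j, k) = (\<Sum>l<m. A $$ (j, l) * B $$ (l, k))"
  using assms by (auto simp: scalar_prod_def atLeast0LessThan intro!: sum.cong)

lemma mult_mat_vec_index:
  assumes "A \<in> carrier_mat n m" "z \<in> carrier_vec m" "j < n"
  shows "(A *\<^sub>v z) $ j = (\<Sum>l<m. A $$ (j, l) * z $ l)"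
  using assms by (auto simp: scalar_prod_def atLeast0LessThan intro!: sum.cong)

lemma pow_mat_smult_index:
  fixes A :: "'a::comm_semiring_1 mat"
  assumes A: "A \<in> carrier_mat n n" and "j < n" "k < n"
  shows "((t \<cdot>\<^sub>m A) ^\<^sub>m m) $$ (j, k) = t ^ m * (A ^\<^sub>m m) $$ (j, k)"
  using assms(2,3)
proof (induction m arbitrary: j k)
  case 0
  then show ?case using A by simp
next
  case (Suc m)
  have tA: "t \<cdot>\<^sub>m A \<in> carrier_mat n n" using A by simp
  show ?case
    unfolding pow_mat_Suc_index[OF tA Suc.prems] pow_mat_Suc_index[OF A Suc.prems]
    using A Suc by (auto simp: sum_distrib_left ac_simps intro!: sum.cong)
qed

lemma pow_mat_add_index:
  fixes A :: "'a::semiring_1 mat"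
  assumes A: "A \<in> carrier_mat n n" and "j < n" "k < n"
  shows "(A ^\<^sub>m (p + q)) $$ (j, k) = (\<Sum>l<n. (A ^\<^sub>m p) $$ (j, l) * (A ^\<^sub>m q) $$ (l, k))"
  using assms(2,3)
proof (induction q arbitrary: j k)
  case 0
  have "(\<Sum>l<n. (A ^\<^sub>m p) $$ (j, l) * (A ^\<^sub>m 0) $$ (l, k)) =
      (\<Sum>l<n. if l = k then (A ^\<^sub>m p) $$ (j, l) else 0)"
    using A 0 by (intro sum.cong) auto
  then show ?case using 0 by (simp del: pow_mat.simps)
next
  case (Suc q)
  have "(A ^\<^sub>m (p + Suc q)) $$ (j, k) =
      (\<Sum>l<n. (\<Sum>i<n. (A ^\<^sub>m p) $$ (j, i) * (A ^\<^sub>m q) $$ (i, l)) * A $$ (l, k))"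
    using Suc pow_mat_Suc_index[OF A, of j k "p + q"] by simp
  also have "\<dots> = (\<Sum>i<n. \<Sum>l<n. (A ^\<^sub>m p) $$ (j, i) * ((A ^\<^sub>m q) $$ (i, l) * A $$ (l, k)))"
    by (subst sum.swap) (simp add: sum_distrib_right mult.assoc)
  also have "\<dots> = (\<Sum>i<n. (A ^\<^sub>m p) $$ (j, i) * (A ^\<^sub>m Suc q) $$ (i, k))"
    using pow_mat_Suc_index[OF A _ Suc.prems(2)]
    by (intro sum.cong) (simp_all add: sum_distrib_left del: pow_mat.simps)
  finally show ?case .
qed

text \<open>Geometric growth of the entries makes the exponential series converge. The sum of the
  absolute values of all entries serves as \<open>b\<close>, because it dominates every column sum
  in the induction step.\<close>

lemma pow_mat_index_bound:
  fixes A :: "real mat"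
  assumes A: "A \<in> carrier_mat n n"
  obtains b where "b \<ge> 0" "\<And>m j k. j < n \<Longrightarrow> k < n \<Longrightarrow> \<bar>(A ^\<^sub>m m) $$ (j, k)\<bar> \<le> b ^ m"
proof -
  define b where "b = (\<Sum>j<n. \<Sum>k<n. \<bar>A $$ (j, k)\<bar>)"
  have b0: "b \<ge> 0" by (auto simp: b_def intro!: sum_nonneg)
  have col: "(\<Sum>l<n. \<bar>A $$ (l, k)\<bar>) \<le> b" if "k < n" for k
    unfolding b_def using that by (intro sum_mono member_le_sum) auto
  have "\<bar>(A ^\<^sub>m m) $$ (j, k)\<bar> \<le> b ^ m" if "j < n" "k < n" for m j k
    using that
  proof (induction m arbitrary: j k)
    case 0
    then show ?case using A by simp
  next
    case (Suc m)
    have "\<bar>(A ^\<^sub>m Suc m) $$ (j, k)\<bar> \<le> (\<Sum>l<n. \<bar>(A ^\<^sub>m m) $$ (j, l)\<bar> * \<bar>A $$ (l, k)\<bar>)"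
      unfolding pow_mat_Suc_index[OF A Suc.prems]
      by (rule order_trans[OF sum_abs]) (simp add: abs_mult)
    also have "\<dots> \<le> (\<Sum>l<n. b ^ m * \<bar>A $$ (l, k)\<bar>)"
      using Suc by (intro sum_mono mult_right_mono) auto
    also have "\<dots> \<le> b ^ m * b"
      using col[OF Suc.prems(2)] b0 by (simp flip: sum_distrib_left add: mult_left_mono)
    finally show ?case by (simp add: ac_simps)
  qed
  with b0 show thesis using that by blast
qed

text \<open>Comparison with the exponential series of \<open>b * \<bar>t\<bar>\<close>. Absolute
  convergence is what the Cauchy product in \<open>mat_exp_add_index\<close> asks for.\<close>

lemma summable_norm_mat_exp:
  fixes A :: "real mat"
  assumes A: "A \<in> carrier_mat n n" and jk: "j < n" "k < n"
  shows "summable (\<lambda>m. norm ((A ^\<^sub>m m) $$ (j, k) * t ^ m / fact m))"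
proof -
  obtain b where b: "b \<ge> 0" "\<And>m j k. j < n \<Longrightarrow> k < n \<Longrightarrow> \<bar>(A ^\<^sub>m m) $$ (j, k)\<bar> \<le> b ^ m"
    using pow_mat_index_bound[OF A] by blast
  have "summable (\<lambda>m. inverse (fact m) * (b * \<bar>t\<bar>) ^ m)" by (rule summable_exp)
  moreover have "norm (norm ((A ^\<^sub>m m) $$ (j, k) * t ^ m / fact m)) \<le> inverse (fact m) * (b * \<bar>t\<bar>) ^ m" for m
    using mult_left_mono[OF b(2)[OF jk, of m], of "\<bar>t\<bar> ^ m"]
    by (simp add: abs_mult power_abs power_mult_distrib divide_inverse ac_simps)
  ultimately show ?thesis by (rule summable_comparison_test'[where N = 0])
qed

lemma mat_exp_carrier [simp]: "A \<in> carrier_mat n n \<Longrightarrow> mat_exp A \<in> carrier_mat n n"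
  by (simp add: mat_exp_def carrier_matD)

text \<open>Pulling \<open>t\<close> out of the powers makes each entry of \<open>exp(tA)\<close> an
  everywhere convergent power series in \<open>t\<close>. Continuity, the semigroup law and the
  passage to Jordan coordinates all start from this form.\<close>

lemma mat_exp_sums:
  assumes A: "A \<in> carrier_mat n n" and jk: "j < n" "k < n"
  shows "(\<lambda>m. (A ^\<^sub>m m) $$ (j, k) * t ^ m / fact m) sums mat_exp (t \<cdot>\<^sub>m A) $$ (j, k)"
proof -
  have "mat_exp (t \<cdot>\<^sub>m A) $$ (j, k) = (\<Sum>m. (A ^\<^sub>m m) $$ (j, k) * t ^ m / fact m)"
    using A jk by (simp add: mat_exp_def pow_mat_smult_index[OF A jk] mult.commute)
  then show ?thesis
    using summable_norm_cancel[OF summable_norm_mat_exp[OF A jk]] by (simp add: summable_sums)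
qed

lemma continuous_on_mat_exp:
  assumes A: "A \<in> carrier_mat n n" and jk: "j < n" "k < n"
  shows "continuous_on S (\<lambda>t. mat_exp (t \<cdot>\<^sub>m A) $$ (j, k))"
proof -
  define c where "c m = (A ^\<^sub>m m) $$ (j, k) / fact m" for m
  have "(\<lambda>m. c m * t ^ m) sums mat_exp (t \<cdot>\<^sub>m A) $$ (j, k)" for t
    using mat_exp_sums[OF A jk, of t] by (simp add: c_def)
  then have eq: "mat_exp (t \<cdot>\<^sub>m A) $$ (j, k) = (\<Sum>m. c m * t ^ m)"
    and summ: "summable (\<lambda>m. c m * t ^ m)" for t
    by (auto simp: sums_iff)
  have "isCont (\<lambda>t. \<Sum>m. c m * t ^ m) t" for t
    using isCont_powser_converges_everywhere[OF summ] .
  then show ?thesis unfolding eq by (intro continuous_at_imp_continuous_on) auto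
qed

text \<open>The semigroup law follows from the Cauchy product of the two entry series: powers of the
  same matrix multiply by adding exponents, and the binomial theorem collects the scalars.\<close>

lemma mat_exp_add_index:
  assumes A: "A \<in> carrier_mat n n" and jk: "j < n" "k < n"
  shows "mat_exp ((s + t) \<cdot>\<^sub>m A) $$ (j, k) =
    (\<Sum>l<n. mat_exp (s \<cdot>\<^sub>m A) $$ (j, l) * mat_exp (t \<cdot>\<^sub>m A) $$ (l, k))"
proof -
  define a where "a j k r m = (A ^\<^sub>m m) $$ (j, k) * r ^ m / fact m" for j k r m
  have "(\<lambda>m. \<Sum>l<n. \<Sum>i\<le>m. a j l s i * a l k t (m - i)) sums
      (\<Sum>l<n. mat_exp (s \<cdot>\<^sub>m A) $$ (j, l) * mat_exp (t \<cdot>\<^sub>m A) $$ (l, k))"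
  proof (rule sums_sum)
    fix l assume "l \<in> {..<n}"
    then have l: "l < n" by simp
    have "(\<Sum>m. a j l s m) = mat_exp (s \<cdot>\<^sub>m A) $$ (j, l)"
      and "(\<Sum>m. a l k t m) = mat_exp (t \<cdot>\<^sub>m A) $$ (l, k)"
      using mat_exp_sums[OF A] jk l by (auto simp: a_def sums_iff)
    moreover have "(\<lambda>m. \<Sum>i\<le>m. a j l s i * a l k t (m - i)) sums ((\<Sum>m. a j l s m) * (\<Sum>m. a l k t m))"
      unfolding a_def using summable_norm_mat_exp[OF A] jk l by (intro Cauchy_product_sums) auto
    ultimately show "(\<lambda>m. \<Sum>i\<le>m. a j l s i * a l k t (m - i)) sums
        (mat_exp (s \<cdot>\<^sub>m A) $$ (j, l) * mat_exp (t \<cdot>\<^sub>m A) $$ (l, k))" by simp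
  qed
  moreover have "(\<Sum>l<n. \<Sum>i\<le>m. a j l s i * a l k t (m - i)) = a j k (s + t) m" for m
  proof -
    have "(\<Sum>l<n. \<Sum>i\<le>m. a j l s i * a l k t (m - i)) =
        (\<Sum>i\<le>m. (\<Sum>l<n. (A ^\<^sub>m i) $$ (j, l) * (A ^\<^sub>m (m - i)) $$ (l, k)) * (s ^ i * t ^ (m - i)) / (fact i * fact (m - i)))"
      by (subst sum.swap) (simp add: a_def sum_distrib_left sum_divide_distrib ac_simps)
    \<comment> \<open>The inner sum over \<open>l\<close> is the entry of the \<open>m\<close>-th
      power whatever \<open>i\<close> is, so it leaves the sum and only the binomial expansion of
      \<open>(s + t) ^ m\<close> remains.\<close>
    also have "\<dots> = (\<Sum>i\<le>m. (A ^\<^sub>m m) $$ (j, k) * (of_nat (m choose i) * s ^ i * t ^ (m - i)) / fact m)"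
    proof (rule sum.cong)
      fix i assume "i \<in> {..m}"
      then have i: "i \<le> m" by simp
      show "(\<Sum>l<n. (A ^\<^sub>m i) $$ (j, l) * (A ^\<^sub>m (m - i)) $$ (l, k)) * (s ^ i * t ^ (m - i)) / (fact i * fact (m - i)) =
          (A ^\<^sub>m m) $$ (j, k) * (of_nat (m choose i) * s ^ i * t ^ (m - i)) / fact m"
        using pow_mat_add_index[OF A jk, of i "m - i"] i
        by (simp add: binomial_fact field_simps)
    qed simp
    also have "\<dots> = a j k (s + t) m"
      unfolding a_def binomial_ring by (simp add: sum_distrib_left sum_divide_distrib)
    finally show ?thesis .
  qed
  ultimately have "a j k (s + t) sums
      (\<Sum>l<n. mat_exp (s \<cdot>\<^sub>m A) $$ (j, l) * mat_exp (t \<cdot>\<^sub>m A) $$ (l, k))" by simp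
  with mat_exp_sums[OF A jk, of "s + t"] show ?thesis
    using sums_unique2 by (fastforce simp: a_def[abs_def])
qed

lemma mat_exp_add_mult_vec:
  assumes A: "A \<in> carrier_mat n n" and z: "z \<in> carrier_vec n"
  shows "mat_exp (s \<cdot>\<^sub>m A) *\<^sub>v (mat_exp (t \<cdot>\<^sub>m A) *\<^sub>v z) = mat_exp ((s + t) \<cdot>\<^sub>m A) *\<^sub>v z"
proof -
  have c: "mat_exp (r \<cdot>\<^sub>m A) \<in> carrier_mat n n" for r using A by simp
  have "mat_exp ((s + t) \<cdot>\<^sub>m A) = mat_exp (s \<cdot>\<^sub>m A) * mat_exp (t \<cdot>\<^sub>m A)"
    using c[of s] c[of t] c[of "s + t"]
    by (intro eq_matI) (auto simp: mat_exp_add_index[OF A] mult_mat_index[OF c c] simp del: index_mult_mat(1))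
  then show ?thesis using assoc_mult_mat_vec[OF c c z] by simp
qed

section \<open>Euclidean and operator norms; Jordan blocks\<close>

lemma enorm_nonneg [simp]: "0 \<le> enorm z"
  by (simp add: enorm_def L2_set_nonneg)

lemma enorm_power2: "(enorm z)\<^sup>2 = (\<Sum>k<dim_vec z. (norm (z $ k))\<^sup>2)"
  by (simp add: enorm_def L2_set_def sum_nonneg)

lemma norm_index_le_enorm: "k < dim_vec z \<Longrightarrow> norm (z $ k) \<le> enorm z"
  unfolding enorm_def by (rule member_le_L2_set) auto

lemma enorm_le_sum: "enorm z \<le> (\<Sum>k<dim_vec z. norm (z $ k))"
  unfolding enorm_def by (rule L2_set_le_sum) auto

lemma enorm_smult [simp]: "enorm (c \<cdot>\<^sub>v z) = norm c * enorm z"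
proof -
  have "enorm (c \<cdot>\<^sub>v z) = L2_set (\<lambda>k. norm c * norm (z $ k)) {..<dim_vec z}"
    unfolding enorm_def by (intro L2_set_cong) (auto simp: norm_mult)
  then show ?thesis by (simp add: enorm_def L2_set_right_distrib)
qed

lemma enorm_of_real [simp]: "enorm (map_vec complex_of_real z) = enorm z"
  unfolding enorm_def by (intro L2_set_cong) auto

text \<open>Each of the \<open>n\<close> coordinates of the product is at most
  \<open>n * c * enorm z\<close>, and the Euclidean norm is at most the sum of the coordinates. The
  crude factor \<open>n^2\<close> is harmless because the dimensions are bounded by
  \<open>d\<close>.\<close>

lemma enorm_mult_mat_vec_entries:
  assumes M: "M \<in> carrier_mat n n" and z: "z \<in> carrier_vec n" and c: "0 \<le> c"
    and entries: "\<And>j k. j < n \<Longrightarrow> k < n \<Longrightarrow> norm (M $$ (j, k)) \<le> c"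
  shows "enorm (M *\<^sub>v z) \<le> c * (real n)\<^sup>2 * enorm z"
proof -
  have "norm ((M *\<^sub>v z) $ j) \<le> real n * (c * enorm z)" if "j < n" for j
  proof -
    have "(M *\<^sub>v z) $ j = (\<Sum>k<n. M $$ (j, k) * z $ k)"
      by (rule mult_mat_vec_index[OF M z that])
    moreover have "norm (\<Sum>k<n. M $$ (j, k) * z $ k) \<le> (\<Sum>k<n. c * enorm z)"
    proof (rule sum_norm_le)
      fix k assume "k \<in> {..<n}"
      then show "norm (M $$ (j, k) * z $ k) \<le> c * enorm z"
        using z c entries[OF that] norm_index_le_enorm[of k z]
        by (auto simp: norm_mult intro!: mult_mono)
    qed
    ultimately show ?thesis by simp
  qed
  then have "(\<Sum>j<n. norm ((M *\<^sub>v z) $ j)) \<le> (\<Sum>j<n. real n * (c * enorm z))"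
    by (intro sum_mono) auto
  with enorm_le_sum[of "M *\<^sub>v z"] M show ?thesis
    by (simp add: power2_eq_square ac_simps)
qed

text \<open>A qualitative bound, which ensures that the supremum in \<open>op_norm\<close> is taken
  over a bounded set.\<close>

lemma enorm_mult_mat_vec_bounded:
  assumes M: "M \<in> carrier_mat n n"
  obtains c where "c \<ge> 0" "\<And>z. z \<in> carrier_vec n \<Longrightarrow> enorm (M *\<^sub>v z) \<le> c * enorm z"
proof -
  define c where "c = (\<Sum>j<n. \<Sum>k<n. norm (M $$ (j, k)))"
  have c: "c \<ge> 0" by (auto simp: c_def intro!: sum_nonneg)
  have "norm (M $$ (j, k)) \<le> c" if "j < n" "k < n" for j k
  proof -
    have "norm (M $$ (j, k)) \<le> (\<Sum>k<n. norm (M $$ (j, k)))"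
      using that by (intro member_le_sum) auto
    also have "\<dots> \<le> c" unfolding c_def
      using that by (intro member_le_sum[of _ _ "\<lambda>j. \<Sum>k<n. norm (M $$ (j, k))"]) (auto intro: sum_nonneg)
    finally show ?thesis .
  qed
  then show thesis
    using that[of "c * (real n)\<^sup>2"] enorm_mult_mat_vec_entries[OF M _ c] c by simp
qed

lemma op_norm:
  fixes M :: "'a::real_normed_field mat"
  assumes M: "M \<in> carrier_mat n n"
  shows op_norm_nonneg: "0 \<le> op_norm M"
    and enorm_mult_mat_vec_le: "z \<in> carrier_vec n \<Longrightarrow> enorm (M *\<^sub>v z) \<le> op_norm M * enorm z"
proof -
  obtain c where c: "c \<ge> 0" "\<And>z. z \<in> carrier_vec n \<Longrightarrow> enorm (M *\<^sub>v z) \<le> c * enorm z"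
    using enorm_mult_mat_vec_bounded[OF M] by blast
  have "bdd_above ((\<lambda>z. enorm (M *\<^sub>v z)) ` {z \<in> carrier_vec n. enorm z \<le> 1})"
  proof (rule bdd_aboveI2)
    fix z :: "'a vec" assume "z \<in> {z \<in> carrier_vec n. enorm z \<le> 1}"
    then show "enorm (M *\<^sub>v z) \<le> c"
      using c(1) c(2)[of z] mult_left_mono[of "enorm z" 1 c] by auto
  qed
  then have unit: "enorm (M *\<^sub>v z) \<le> op_norm M" if "z \<in> carrier_vec n" "enorm z \<le> 1" for z
    unfolding op_norm_def carrier_matD(2)[OF M] by (rule cSUP_upper[rotated]) (use that in auto)
  \<comment> \<open>The zero vector lies in the unit ball, so the supremum dominates a nonnegative
    number.\<close>
  have "enorm (0\<^sub>v n :: 'a vec) = 0" by (simp add: enorm_def L2_set_def)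
  then have "enorm (M *\<^sub>v 0\<^sub>v n) \<le> op_norm M" by (intro unit) auto
  then show "0 \<le> op_norm M" by (rule order_trans[OF enorm_nonneg])
  show "enorm (M *\<^sub>v z) \<le> op_norm M * enorm z" if z: "z \<in> carrier_vec n"
  proof (cases "enorm z = 0")
    case True
    then show ?thesis using c(2)[OF z] by simp
  next
    case False
    then have pos: "enorm z > 0" using enorm_nonneg[of z] by linarith
    \<comment> \<open>Scaling \<open>z\<close> to norm one; \<open>of_real\<close> places the factor
      in the scalar field, which may be real or complex.\<close>
    define r :: 'a where "r = of_real (1 / enorm z)"
    have r: "norm r = 1 / enorm z" by (simp add: r_def norm_divide)
    have "enorm (M *\<^sub>v (r \<cdot>\<^sub>v z)) = enorm (M *\<^sub>v z) / enorm z"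
      using r by (simp add: mult_mat_vec[OF M z])
    moreover have "enorm (M *\<^sub>v (r \<cdot>\<^sub>v z)) \<le> op_norm M"
      using z r pos by (intro unit) auto
    ultimately show ?thesis using pos by (simp add: pos_divide_le_eq)
  qed
qed

text \<open>A weighted Young inequality: the difference of the two sides is a sum of squares
  \<open>(q a - p b)^2 / (p q)\<close> over the coordinates. The free weights let it replace the
  Minkowski inequality in \<open>controls_add\<close>.\<close>

lemma enorm_add_power2_le:
  fixes y z :: "real vec"
  assumes y: "y \<in> carrier_vec n" and z: "z \<in> carrier_vec n" and p: "p > 0" and q: "q > 0"
  shows "(enorm (y + z))\<^sup>2 \<le> (p + q) / p * (enorm y)\<^sup>2 + (p + q) / q * (enorm z)\<^sup>2"
proof -
  have pt: "(a + b)\<^sup>2 \<le> (p + q) / p * a\<^sup>2 + (p + q) / q * b\<^sup>2" for a b :: real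
  proof -
    have "(p + q) / p * a\<^sup>2 + (p + q) / q * b\<^sup>2 - (a + b)\<^sup>2 = (q * a - p * b)\<^sup>2 / (p * q)"
      using p q by (simp add: field_simps power2_eq_square)
    moreover have "\<dots> \<ge> 0" using p q by simp
    ultimately show ?thesis by linarith
  qed
  show ?thesis
    using y z pt by (simp add: enorm_power2 sum_distrib_left flip: sum.distrib) (auto intro!: sum_mono)
qed

lemma ell2_add:
  assumes y: "y \<in> ell2 n" and z: "z \<in> ell2 n"
  shows "(\<lambda>i. y i + z i) \<in> ell2 n"
proof -
  have c: "y i \<in> carrier_vec (n i)" "z i \<in> carrier_vec (n i)" for i
    using y z by (auto simp: ell2_def)
  have "summable (\<lambda>i. 2 * (enorm (y i))\<^sup>2 + 2 * (enorm (z i))\<^sup>2)"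
    using y z by (intro summable_add summable_mult) (auto simp: ell2_def)
  then have "summable (\<lambda>i. (enorm (y i + z i))\<^sup>2)"
    using enorm_add_power2_le[OF c, of 1 1] by (auto intro: summable_comparison_test')
  then show ?thesis using c by (auto simp: ell2_def)
qed

section \<open>Powers of Jordan matrices and the exponential series of their entries\<close>

lemma jordan_matrix_pow_index:
  fixes n_as :: "(nat \<times> 'a::comm_ring_1) list"
  assumes "j < sum_list (map fst n_as)" "k < sum_list (map fst n_as)"
  shows "(\<forall>m. (jordan_matrix n_as ^\<^sub>m m) $$ (j, k) = 0) \<or>
    (\<exists>p. \<exists>a\<in>snd ` set n_as. \<forall>m. (jordan_matrix n_as ^\<^sub>m m) $$ (j, k) = of_nat (m choose p) * a ^ (m - p))"
  using assms
proof (induction n_as arbitrary: j k)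
  case Nil
  then show ?case by simp
next
  case (Cons na n_as)
  obtain n a where na: "na = (n, a)" by force
  define s where "s = sum_list (map fst n_as)"
  \<comment> \<open>Powers of a block diagonal matrix are formed blockwise, so the induction splits
    off the first Jordan block.\<close>
  have eq: "jordan_matrix (na # n_as) ^\<^sub>m m = four_block_mat (jordan_block n a ^\<^sub>m m)
      (0\<^sub>m n s) (0\<^sub>m s n) (jordan_matrix n_as ^\<^sub>m m)" for m
  proof -
    have "jordan_matrix n_as ^\<^sub>m m \<in> carrier_mat s s"
      unfolding s_def by (rule pow_carrier_mat) simp
    then show ?thesis unfolding jordan_matrix_pow[of "na # n_as"]
      by (auto simp: na Let_def s_def four_block_one_mat simp flip: jordan_matrix_pow)
  qed
  have dim: "jordan_matrix n_as ^\<^sub>m m \<in> carrier_mat s s" for m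
    unfolding s_def by (rule pow_carrier_mat) simp
  have jk: "j < n + s" "k < n + s" using Cons.prems by (auto simp: na s_def)
  have entry: "(jordan_matrix (na # n_as) ^\<^sub>m m) $$ (j, k) =
      (if j < n then if k < n then (jordan_block n a ^\<^sub>m m) $$ (j, k) else 0
       else if k < n then 0 else (jordan_matrix n_as ^\<^sub>m m) $$ (j - n, k - n))" for m
    unfolding eq using jk carrier_matD[OF dim[of m]] by (subst index_mat_four_block(1)) auto
  \<comment> \<open>The position decides the form of the entry once for all \<open>m\<close>: on or
    above the diagonal of the first block (\<open>p = k - j\<close>), below it, off the block
    diagonal, or in the remaining blocks.\<close>
  consider "j < n" "k < n" "j \<le> k" | "j < n" "k < n" "\<not> j \<le> k" | "j < n \<longleftrightarrow> \<not> k < n" | "\<not> j < n" "\<not> k < n"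
    by blast
  then show ?case
  proof cases
    case 1
    then have "\<forall>m. (jordan_matrix (na # n_as) ^\<^sub>m m) $$ (j, k) = of_nat (m choose (k - j)) * a ^ (m - (k - j))"
      by (simp add: entry jordan_block_pow)
    then show ?thesis using na by (intro disjI2 exI[of _ "k - j"] bexI[of _ a]) auto
  next
    case 2
    then show ?thesis by (simp add: entry jordan_block_pow)
  next
    case 3
    then show ?thesis by (auto simp: entry)
  next
    case 4
    then have "j - n < s" "k - n < s" using jk by auto
    from Cons.IH[OF this[unfolded s_def]] 4 show ?thesis by (auto simp: entry)
  qed
qed

text \<open>The terms with \<open>m < p\<close> vanish with the binomial coefficient; after a shift
  by \<open>p\<close> the rest is \<open>x ^ p / fact p\<close> times the exponential series of
  \<open>a * x\<close>.\<close>

lemma jordan_entry_sums: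
  fixes a x :: complex
  shows "(\<lambda>m. of_nat (m choose p) * a ^ (m - p) * x ^ m / fact m) sums (x ^ p / fact p * exp (a * x))"
proof -
  define g where "g m = of_nat (m choose p) * a ^ (m - p) * x ^ m / fact m" for m
  have "g (m + p) = x ^ p / fact p * ((a * x) ^ m /\<^sub>R fact m)" for m
    using binomial_fact[of p "m + p", where ?'a = complex]
    by (simp add: g_def power_add power_mult_distrib scaleR_conv_of_real field_simps)
  then have "(\<lambda>m. g (m + p)) sums (x ^ p / fact p * exp (a * x))"
    using sums_mult[OF exp_converges, of "x ^ p / fact p" "a * x"] by simp
  then have "g sums (x ^ p / fact p * exp (a * x))"
    by (subst (asm) sums_zero_iff_shift) (auto simp: g_def)
  then show ?thesis by (simp add: g_def[abs_def])
qed

lemma power_over_fact_le_exp: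
  fixes x :: real
  assumes "x \<ge> 0"
  shows "x ^ p / fact p \<le> exp x"
proof -
  have s: "(\<lambda>m. x ^ m /\<^sub>R fact m) sums exp x" by (rule exp_converges)
  have "(\<Sum>m\<in>{p}. x ^ m /\<^sub>R fact m) \<le> (\<Sum>m. x ^ m /\<^sub>R fact m)"
    using s assms by (intro sum_le_suminf) (auto simp: sums_iff)
  then show ?thesis using s by (simp add: sums_iff divide_inverse mult.commute)
qed

text \<open>On \<open>[0,1]\<close> both \<open>t ^ p / fact p\<close> and the exponential are at
  most one, whatever the eigenvalue. For arbitrary \<open>t\<close>,
  \<open>power_over_fact_le_exp\<close> at \<open>- Re a * t\<close> lets the decay absorb the
  power; for \<open>p > 0\<close> this bound degenerates as \<open>Re a\<close> tends to
  zero.\<close>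

lemma jordan_entry_bound:
  fixes a :: complex
  assumes a: "Re a < 0"
  shows "0 \<le> t \<Longrightarrow> t \<le> 1 \<Longrightarrow> norm (of_real t ^ p / fact p * exp (a * of_real t)) \<le> 1"
    and "0 \<le> t \<Longrightarrow> norm (of_real t ^ p / fact p * exp (a * of_real t)) \<le> inverse ((- Re a) ^ p)"
proof -
  have eq: "norm (of_real t ^ p / fact p * exp (a * of_real t)) = t ^ p / fact p * exp (Re a * t)" if "t \<ge> 0"
    using that by (simp add: norm_mult norm_divide norm_power)
  { assume t: "0 \<le> t" "t \<le> 1"
    have "t ^ p / fact p \<le> 1"
      using order_trans[OF power_le_one[OF t, of p] fact_ge_1[of p]] by (simp add: divide_le_eq)
    moreover have "exp (Re a * t) \<le> 1" using t a by (simp add: mult_nonpos_nonneg)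
    ultimately have "t ^ p / fact p * exp (Re a * t) \<le> 1 * 1"
      using t by (intro mult_mono) auto
    then show "norm (of_real t ^ p / fact p * exp (a * of_real t)) \<le> 1" using eq t by simp }
  { assume t: "0 \<le> t"
    have "(- Re a) ^ p * (t ^ p / fact p * exp (Re a * t)) = (- Re a * t) ^ p / fact p * exp (Re a * t)"
      by (simp flip: power_mult_distrib)
    also have "\<dots> \<le> exp (- Re a * t) * exp (Re a * t)"
      using a t by (intro mult_right_mono power_over_fact_le_exp) (auto simp: mult_nonpos_nonneg)
    also have "\<dots> = 1" by (simp flip: exp_add)
    finally have "t ^ p / fact p * exp (Re a * t) * (- Re a) ^ p \<le> 1" by (simp only: mult.commute)
    moreover have "(- Re a) ^ p > 0" using a by simp
    ultimately show "norm (of_real t ^ p / fact p * exp (a * of_real t)) \<le> inverse ((- Re a) ^ p)"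
      unfolding eq[OF t] inverse_eq_divide by (simp only: pos_le_divide_eq) }
qed

text \<open>The characteristic polynomial is the product of the factors \<open>(X - a) ^ r\<close>
  over the blocks. Excluding blocks of size zero makes each listed \<open>a\<close> a root.\<close>

lemma jordan_nf_eigenvalue:
  fixes A :: "'a::field mat"
  assumes A: "A \<in> carrier_mat n n" and nf: "jordan_nf A n_as" and a: "a \<in> snd ` set n_as"
  shows "eigenvalue A a"
proof -
  obtain r where r: "(r, a) \<in> set n_as" using a by force
  then have "r \<noteq> 0" using nf by (force simp: jordan_nf_def)
  then have "poly ([:- a, 1:] ^ r) a = 0" by (simp add: poly_power)
  then have "poly (\<Prod>(r, a)\<leftarrow>n_as. [:- a, 1:] ^ r) a = 0"
    using r by (induction n_as) auto
  then show ?thesis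
    using eigenvalue_root_char_poly[OF A] jordan_nf_char_poly[OF nf] by simp
qed

section \<open>The flow in Jordan coordinates\<close>

text \<open>The function \<open>f\<close> is an entry of the exponential of the complex Jordan
  matrix. It is given as the sum of a series because \<open>mat_exp\<close> is defined for real
  matrices only.\<close>

lemma jordan_matrix_exp_entry:
  assumes neg: "\<And>a. a \<in> snd ` set n_as \<Longrightarrow> Re a < 0"
    and jk: "j < sum_list (map fst n_as)" "k < sum_list (map fst n_as)"
  shows "\<exists>f c. (\<forall>t. (\<lambda>m. (jordan_matrix n_as ^\<^sub>m m) $$ (j, k) * of_real t ^ m / fact m) sums f t) \<and>
    (\<forall>t. 0 \<le> t \<and> t \<le> 1 \<longrightarrow> norm (f t) \<le> 1) \<and> (\<forall>t\<ge>0. norm (f t) \<le> c)"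
  using jordan_matrix_pow_index[OF jk]
proof
  assume "\<forall>m. (jordan_matrix n_as ^\<^sub>m m) $$ (j, k) = 0"
  then show ?thesis by (intro exI[of _ "\<lambda>_. 0"] exI[of _ 0]) simp
next
  assume "\<exists>p. \<exists>a\<in>snd ` set n_as. \<forall>m. (jordan_matrix n_as ^\<^sub>m m) $$ (j, k) = of_nat (m choose p) * a ^ (m - p)"
  then obtain p a where a: "a \<in> snd ` set n_as"
    and eq: "(jordan_matrix n_as ^\<^sub>m m) $$ (j, k) = of_nat (m choose p) * a ^ (m - p)" for m
    by blast
  have "Re a < 0" using neg a .
  from jordan_entry_bound[OF this] show ?thesis
    unfolding eq using jordan_entry_sums
    by (intro exI[of _ "\<lambda>t. of_real t ^ p / fact p * exp (a * of_real t)"] exI[of _ "inverse ((- Re a) ^ p)"]) blast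
qed

text \<open>\<open>E t\<close> plays the role of \<open>exp(tJ)\<close>. The similarity holds for
  every power of the matrix and passes termwise to the exponential series.\<close>

lemma mat_exp_jordan:
  assumes A: "A \<in> carrier_mat n n"
    and wit: "similar_mat_wit (jordan_matrix n_as) (map_mat complex_of_real A) P Q"
    and neg: "\<And>a. a \<in> snd ` set n_as \<Longrightarrow> Re a < 0"
  obtains E c where "\<And>t. E t \<in> carrier_mat n n"
    and "\<And>t. map_mat complex_of_real (mat_exp (t \<cdot>\<^sub>m A)) = Q * E t * P"
    and "\<And>t j k. 0 \<le> t \<Longrightarrow> t \<le> 1 \<Longrightarrow> j < n \<Longrightarrow> k < n \<Longrightarrow> norm (E t $$ (j, k)) \<le> 1"
    and "c \<ge> 0" and "\<And>t j k. 0 \<le> t \<Longrightarrow> j < n \<Longrightarrow> k < n \<Longrightarrow> norm (E t $$ (j, k)) \<le> c"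
proof -
  define J where "J = jordan_matrix n_as"
  have cA: "map_mat complex_of_real A \<in> carrier_mat n n" using A by simp
  note wit' = similar_mat_wit_sym[OF wit]
  have J: "J \<in> carrier_mat n n" and Q: "Q \<in> carrier_mat n n" and P: "P \<in> carrier_mat n n"
    using similar_mat_witD2[OF cA wit'] by (auto simp: J_def)
  then have dim: "sum_list (map fst n_as) = n"
    using jordan_matrix_dim(1)[of n_as] by (metis J_def carrier_matD(1))
  have Jm: "J ^\<^sub>m m \<in> carrier_mat n n" for m using J by simp
  have pow: "map_mat complex_of_real (A ^\<^sub>m m) = Q * J ^\<^sub>m m * P" for m
    unfolding of_real_hom.mat_hom_pow[OF A] J_def by (rule similar_mat_wit_pow_id[OF wit'])
  define R where "R j k f c \<longleftrightarrow>
      (\<forall>t. (\<lambda>m. (J ^\<^sub>m m) $$ (j, k) * of_real t ^ m / fact m) sums f t) \<and>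
      (\<forall>t. 0 \<le> t \<and> t \<le> 1 \<longrightarrow> norm (f t) \<le> 1) \<and> (\<forall>t\<ge>0. norm (f t) \<le> c)"
    for j k and f :: "real \<Rightarrow> complex" and c :: real
  have ex: "\<exists>f c. R j k f c" if "j < n" "k < n" for j k
    unfolding R_def J_def by (rule jordan_matrix_exp_entry[OF neg]) (use that dim in auto)
  \<comment> \<open>Two successive choices: first the sum function of each entry, then a bound
    belonging to this particular function.\<close>
  define f where "f j k = (SOME f. \<exists>c. R j k f c)" for j k
  define b where "b j k = (SOME c. R j k (f j k) c)" for j k
  have "R j k (f j k) (b j k)" if "j < n" "k < n" for j k
    using someI_ex[OF someI_ex[OF ex[OF that]]] by (simp only: f_def b_def)
  then have f: "\<And>j k t. j < n \<Longrightarrow> k < n \<Longrightarrow> (\<lambda>m. (J ^\<^sub>m m) $$ (j, k) * of_real t ^ m / fact m) sums f j k t"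
    and f1: "\<And>j k t. j < n \<Longrightarrow> k < n \<Longrightarrow> 0 \<le> t \<Longrightarrow> t \<le> 1 \<Longrightarrow> norm (f j k t) \<le> 1"
    and fb: "\<And>j k t. j < n \<Longrightarrow> k < n \<Longrightarrow> 0 \<le> t \<Longrightarrow> norm (f j k t) \<le> b j k"
    unfolding R_def by blast+
  define E where "E t = mat n n (\<lambda>(j, k). f j k t)" for t
  \<comment> \<open>Inserting \<open>0\<close> keeps the maximum defined in dimension zero and makes
    \<open>c\<close> nonnegative.\<close>
  define c where "c = Max (insert 0 ((\<lambda>(j, k). b j k) ` ({..<n} \<times> {..<n})))"
  have E: "E t \<in> carrier_mat n n" for t by (simp add: E_def)
  have QE: "Q * E t \<in> carrier_mat n n" and QJ: "Q * J ^\<^sub>m m \<in> carrier_mat n n" for t m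
    using Q E Jm by auto
  show thesis
  proof (rule that[of E c])
    fix t
    have entry: "of_real (mat_exp (t \<cdot>\<^sub>m A) $$ (j, k)) = (Q * E t * P) $$ (j, k)" if jk: "j < n" "k < n" for j k
    proof -
      have "(\<lambda>m. complex_of_real ((A ^\<^sub>m m) $$ (j, k) * t ^ m / fact m)) sums of_real (mat_exp (t \<cdot>\<^sub>m A) $$ (j, k))"
        by (rule sums_of_real) (rule mat_exp_sums[OF A jk])
      moreover have "complex_of_real ((A ^\<^sub>m m) $$ (j, k) * t ^ m / fact m) =
          (\<Sum>l<n. (\<Sum>i<n. Q $$ (j, i) * ((J ^\<^sub>m m) $$ (i, l) * of_real t ^ m / fact m)) * P $$ (l, k))" for m
      proof -
        have "complex_of_real ((A ^\<^sub>m m) $$ (j, k)) = (Q * J ^\<^sub>m m * P) $$ (j, k)"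
          using A jk by (simp flip: pow)
        also have "\<dots> = (\<Sum>l<n. (\<Sum>i<n. Q $$ (j, i) * (J ^\<^sub>m m) $$ (i, l)) * P $$ (l, k))"
          unfolding mult_mat_index[OF QJ P jk] using mult_mat_index[OF Q Jm jk(1)] by simp
        finally show ?thesis
          by (simp add: sum_distrib_right sum_distrib_left sum_divide_distrib ac_simps)
      qed
      moreover have "(\<lambda>m. \<Sum>l<n. (\<Sum>i<n. Q $$ (j, i) * ((J ^\<^sub>m m) $$ (i, l) * of_real t ^ m / fact m)) * P $$ (l, k))
          sums (\<Sum>l<n. (\<Sum>i<n. Q $$ (j, i) * f i l t) * P $$ (l, k))"
        using f by (intro sums_sum sums_mult sums_mult2) auto
      moreover have "(\<Sum>l<n. (\<Sum>i<n. Q $$ (j, i) * f i l t) * P $$ (l, k)) = (Q * E t * P) $$ (j, k)"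
        unfolding mult_mat_index[OF QE P jk] using mult_mat_index[OF Q E jk(1)] by (simp add: E_def)
      ultimately show ?thesis by (simp add: sums_unique2)
    qed
    have c1: "mat_exp (t \<cdot>\<^sub>m A) \<in> carrier_mat n n" using A by simp
    have c2: "Q * E t * P \<in> carrier_mat n n" using QE P by (rule mult_carrier_mat)
    show "map_mat complex_of_real (mat_exp (t \<cdot>\<^sub>m A)) = Q * E t * P"
    proof (rule eq_matI)
      fix j k assume "j < dim_row (Q * E t * P)" "k < dim_col (Q * E t * P)"
      then have jk: "j < n" "k < n" using carrier_matD[OF c2] by simp_all
      show "map_mat complex_of_real (mat_exp (t \<cdot>\<^sub>m A)) $$ (j, k) = (Q * E t * P) $$ (j, k)"
        unfolding entry[OF jk, symmetric] using jk carrier_matD[OF c1] by simp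
    qed (use carrier_matD[OF c1] carrier_matD[OF c2] in simp_all)
  next
    fix t :: real and j k assume *: "0 \<le> t" "j < n" "k < n"
    then have "b j k \<le> c" unfolding c_def by (intro Max_ge) auto
    then show "norm (E t $$ (j, k)) \<le> c" using fb[of j k t] * by (simp add: E_def)
  qed (use E f1 in \<open>auto simp: E_def c_def\<close>)
qed

text \<open>Conjugation costs the factor \<open>op_norm P * op_norm Q\<close>, which uniform
  normalizability controls. Entries at most one on \<open>[0,1]\<close> give the quantitative bound;
  the entry bound \<open>c\<close>, which depends on the matrix, gives boundedness for all
  times.\<close>

lemma mat_exp_bounds:
  assumes A: "A \<in> carrier_mat n n"
    and wit: "similar_mat_wit (jordan_matrix n_as) (map_mat complex_of_real A) P Q"
    and neg: "\<And>a. a \<in> snd ` set n_as \<Longrightarrow> Re a < 0"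
    and z: "z \<in> carrier_vec n"
  shows "0 \<le> t \<Longrightarrow> t \<le> 1 \<Longrightarrow>
      enorm (mat_exp (t \<cdot>\<^sub>m A) *\<^sub>v z) \<le> op_norm P * op_norm Q * (real n)\<^sup>2 * enorm z"
    and "\<exists>M. \<forall>t\<ge>0. enorm (mat_exp (t \<cdot>\<^sub>m A) *\<^sub>v z) \<le> M"
proof -
  obtain E c where E: "\<And>t. E t \<in> carrier_mat n n"
    and eq: "\<And>t. map_mat complex_of_real (mat_exp (t \<cdot>\<^sub>m A)) = Q * E t * P"
    and E1: "\<And>t j k. 0 \<le> t \<Longrightarrow> t \<le> 1 \<Longrightarrow> j < n \<Longrightarrow> k < n \<Longrightarrow> norm (E t $$ (j, k)) \<le> 1"
    and c: "c \<ge> 0" and Ec: "\<And>t j k. 0 \<le> t \<Longrightarrow> j < n \<Longrightarrow> k < n \<Longrightarrow> norm (E t $$ (j, k)) \<le> c"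
    using mat_exp_jordan[OF A wit neg] by blast
  have cA: "map_mat complex_of_real A \<in> carrier_mat n n" using A by simp
  have Q: "Q \<in> carrier_mat n n" and P: "P \<in> carrier_mat n n"
    using similar_mat_witD2[OF cA similar_mat_wit_sym[OF wit]] by auto
  have bound: "enorm (mat_exp (t \<cdot>\<^sub>m A) *\<^sub>v z) \<le> op_norm P * op_norm Q * (real n)\<^sup>2 * enorm z * r"
    if r: "r \<ge> 0" "\<And>j k. j < n \<Longrightarrow> k < n \<Longrightarrow> norm (E t $$ (j, k)) \<le> r" for r t
  proof -
    \<comment> \<open>The Jordan basis is complex, so the estimate is made for the complexified
      vector, which has the same norm.\<close>
    define y where "y = map_vec complex_of_real z"
    have y: "y \<in> carrier_vec n" using z by (simp add: y_def)
    have Py: "P *\<^sub>v y \<in> carrier_vec n" and EPy: "E t *\<^sub>v (P *\<^sub>v y) \<in> carrier_vec n"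
      using P E[of t] y by auto
    have me: "mat_exp (t \<cdot>\<^sub>m A) \<in> carrier_mat n n" using A by simp
    have "map_vec complex_of_real (mat_exp (t \<cdot>\<^sub>m A) *\<^sub>v z) = Q * E t * P *\<^sub>v y"
      unfolding of_real_hom.mult_mat_vec_hom[OF me z] eq y_def ..
    also have "\<dots> = Q *\<^sub>v (E t *\<^sub>v (P *\<^sub>v y))"
      using Q P E[of t] y Py by (simp add: assoc_mult_mat_vec[of _ n n _ n])
    finally have "enorm (mat_exp (t \<cdot>\<^sub>m A) *\<^sub>v z) = enorm (Q *\<^sub>v (E t *\<^sub>v (P *\<^sub>v y)))"
      using enorm_of_real by metis
    also have "\<dots> \<le> op_norm Q * enorm (E t *\<^sub>v (P *\<^sub>v y))"
      by (rule enorm_mult_mat_vec_le[OF Q EPy])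
    also have "\<dots> \<le> op_norm Q * (r * (real n)\<^sup>2 * enorm (P *\<^sub>v y))"
      by (intro mult_left_mono enorm_mult_mat_vec_entries[OF E Py] op_norm_nonneg[OF Q] r)
    also have "\<dots> \<le> op_norm Q * (r * (real n)\<^sup>2 * (op_norm P * enorm y))"
      using r by (intro mult_left_mono enorm_mult_mat_vec_le[OF P y] op_norm_nonneg[OF Q]) auto
    finally show ?thesis by (simp add: y_def ac_simps)
  qed
  show "0 \<le> t \<Longrightarrow> t \<le> 1 \<Longrightarrow>
      enorm (mat_exp (t \<cdot>\<^sub>m A) *\<^sub>v z) \<le> op_norm P * op_norm Q * (real n)\<^sup>2 * enorm z"
    using bound[of 1 t] E1[of t] by simp
  show "\<exists>M. \<forall>t\<ge>0. enorm (mat_exp (t \<cdot>\<^sub>m A) *\<^sub>v z) \<le> M"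
    using bound[OF c Ec] by blast
qed

section \<open>Control spaces\<close>

text \<open>Summability ignores finitely many terms, so the slowly steered components with index
  below \<open>N\<close> need no estimate.\<close>

lemma ell2_eventually_le:
  assumes x: "x \<in> ell2 n" and y: "\<And>i. y i \<in> carrier_vec (n i)"
    and le: "\<And>i. i \<ge> N \<Longrightarrow> enorm (y i) \<le> K * enorm (x i)"
  shows "y \<in> ell2 n"
proof -
  have "summable (\<lambda>i. K\<^sup>2 * (enorm (x i))\<^sup>2)"
    using x by (intro summable_mult) (simp add: ell2_def)
  moreover have "norm ((enorm (y i))\<^sup>2) \<le> K\<^sup>2 * (enorm (x i))\<^sup>2" if "i \<ge> N" for i
    using power_mono[OF le[OF that], of 2] by (simp add: power_mult_distrib)
  ultimately have "summable (\<lambda>i. (enorm (y i))\<^sup>2)" by (rule summable_comparison_test')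
  then show ?thesis using y by (simp add: ell2_def)
qed

text \<open>The triangle inequality for the energy norm, obtained by integrating and summing a
  pointwise quadratic inequality instead of taking roots in the extended reals.\<close>

lemma controls_add:
  assumes v: "v \<in> controls n T \<sigma>" and w: "w \<in> controls n T \<delta>" and pos: "\<sigma> > 0" "\<delta> > 0"
  shows "(\<lambda>t i. v t i + w t i) \<in> controls n T (\<sigma> + \<delta>)"
proof -
  have c: "v t i \<in> carrier_vec (n i)" "w t i \<in> carrier_vec (n i)" if "t \<in> {0..T}" for t i
    using v w that by (auto simp: controls_def ell2_def)
  have meas: "(\<lambda>t. ennreal ((enorm (w t i))\<^sup>2)) \<in> borel_measurable (lebesgue_on {0..T})"
    if "w \<in> controls n T \<theta>" for w \<theta> i
  proof -
    have "(\<lambda>t. ennreal (\<Sum>k<n i. (w t i $ k)\<^sup>2)) \<in> borel_measurable (lebesgue_on {0..T})"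
      using that unfolding controls_def
      by (intro measurable_compose[OF _ measurable_ennreal] borel_measurable_sum borel_measurable_power) auto
    \<comment> \<open>The dimension of \<open>w t i\<close> is known only for \<open>t\<close> in
      \<open>[0,T]\<close>; there the squared norm is a sum over a fixed finite index set.\<close>
    moreover have eq: "ennreal ((enorm (w t i))\<^sup>2) = ennreal (\<Sum>k<n i. (w t i $ k)\<^sup>2)"
      if "t \<in> space (lebesgue_on {0..T})" for t
    proof -
      have "w t i \<in> carrier_vec (n i)"
        using that \<open>w \<in> controls n T \<theta>\<close> by (auto simp: controls_def ell2_def)
      from carrier_vecD[OF this] show ?thesis by (simp add: enorm_power2)
    qed
    ultimately show ?thesis by (subst measurable_cong[OF eq])
  qed
  have coord: "(\<lambda>t. (v t i + w t i) $ k) \<in> borel_measurable (lebesgue_on {0..T})" if "k < n i" for i k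
  proof -
    have "(\<lambda>t. v t i $ k + w t i $ k) \<in> borel_measurable (lebesgue_on {0..T})"
      using v w that unfolding controls_def by (intro borel_measurable_add) auto
    moreover have eq: "(v t i + w t i) $ k = v t i $ k + w t i $ k" if "t \<in> space (lebesgue_on {0..T})" for t
      using c[of t i] that \<open>k < n i\<close> by simp
    ultimately show ?thesis by (subst measurable_cong[OF eq])
  qed
  \<comment> \<open>These weights make Young's inequality sharp for the budgets:
    \<open>p * \<sigma>^2 + q * \<delta>^2 = (\<sigma> + \<delta>)^2\<close>.\<close>
  define p q where "p = (\<sigma> + \<delta>) / \<sigma>" and "q = (\<sigma> + \<delta>) / \<delta>"
  have pq: "p \<ge> 0" "q \<ge> 0" using pos by (auto simp: p_def q_def)
  define I where "I w i = (\<integral>\<^sup>+ s. ennreal ((enorm (w s i))\<^sup>2) \<partial>lebesgue_on {0..T})"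
    for w :: "real \<Rightarrow> nat \<Rightarrow> real vec" and i
  have I: "I (\<lambda>t i. v t i + w t i) i \<le> ennreal p * I v i + ennreal q * I w i" for i
  proof -
    have "I (\<lambda>t i. v t i + w t i) i \<le>
        (\<integral>\<^sup>+ s. ennreal p * ennreal ((enorm (v s i))\<^sup>2) + ennreal q * ennreal ((enorm (w s i))\<^sup>2) \<partial>lebesgue_on {0..T})"
      unfolding I_def
    proof (rule nn_integral_mono)
      fix s assume "s \<in> space (lebesgue_on {0..T})"
      then have s: "s \<in> {0..T}" by simp
      have "(enorm (v s i + w s i))\<^sup>2 \<le> p * (enorm (v s i))\<^sup>2 + q * (enorm (w s i))\<^sup>2"
        unfolding p_def q_def by (rule enorm_add_power2_le[OF c[OF s] pos])
      then show "ennreal ((enorm (v s i + w s i))\<^sup>2) \<le>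
          ennreal p * ennreal ((enorm (v s i))\<^sup>2) + ennreal q * ennreal ((enorm (w s i))\<^sup>2)"
        using pq by (simp flip: ennreal_mult ennreal_plus add: ennreal_leI)
    qed
    also have "\<dots> = ennreal p * I v i + ennreal q * I w i"
      unfolding I_def using meas[OF v, of i] meas[OF w, of i]
      by (simp add: nn_integral_add nn_integral_cmult)
    finally show ?thesis .
  qed
  have "(\<Sum>i. I (\<lambda>t i. v t i + w t i) i) \<le> (\<Sum>i. ennreal p * I v i + ennreal q * I w i)"
    using I by (intro suminf_le) auto
  also have "\<dots> = ennreal p * (\<Sum>i. I v i) + ennreal q * (\<Sum>i. I w i)"
    by (subst suminf_add[OF summableI summableI, symmetric]) simp
  also have "\<dots> \<le> ennreal p * ennreal (\<sigma>\<^sup>2) + ennreal q * ennreal (\<delta>\<^sup>2)"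
    using v w by (intro add_mono mult_left_mono) (auto simp: controls_def I_def)
  also have "\<dots> = ennreal ((\<sigma> + \<delta>)\<^sup>2)"
    using pos pq by (simp flip: ennreal_mult ennreal_plus)
      (simp add: p_def q_def field_simps power2_eq_square)
  finally show ?thesis
    using v w coord ell2_add by (auto simp: controls_def I_def)
qed

text \<open>The time profile of the steering control. Its integral grows linearly and then stays
  constant, which produces the factor \<open>min t (\<theta> i)\<close> in
  \<open>trajectory\<close>.\<close>

lemma step_function_lebesgue_on:
  fixes \<theta> c :: real
  shows borel_measurable_step: "(\<lambda>s. if s \<le> \<theta> then c else 0) \<in> borel_measurable (lebesgue_on {0..T})"
    and integral_step: "0 \<le> T \<Longrightarrow> 0 \<le> \<theta> \<Longrightarrow>
      (\<integral>s. (if s \<le> \<theta> then c else 0) \<partial>lebesgue_on {0..T}) = c * min T \<theta>"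
proof -
  have "(\<lambda>s. if s \<le> \<theta> then c else 0) \<in> borel_measurable borel" by measurable
  then have "(\<lambda>s. if s \<le> \<theta> then c else 0) \<in> borel_measurable lebesgue"
    by (simp add: measurable_completion)
  then show "(\<lambda>s. if s \<le> \<theta> then c else 0) \<in> borel_measurable (lebesgue_on {0..T})"
    by (rule measurable_restrict_space1)
  assume *: "0 \<le> T" "0 \<le> \<theta>"
  have "(\<integral>s. (if s \<le> \<theta> then c else 0) \<partial>lebesgue_on {0..T}) = (\<integral>s. c * indicator {0..\<theta>} s \<partial>lebesgue_on {0..T})"
    by (intro Bochner_Integration.integral_cong) auto
  also have "\<dots> = c * measure (lebesgue_on {0..T}) ({0..\<theta>} \<inter> {0..T})" by simp
  also have "measure (lebesgue_on {0..T}) ({0..\<theta>} \<inter> {0..T}) = measure lebesgue {0..min T \<theta>}"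
    by (subst measure_restrict_space) (auto intro!: arg_cong[where f = "measure lebesgue"])
  also have "\<dots> = min T \<theta>" using * by simp
  finally show "(\<integral>s. (if s \<le> \<theta> then c else 0) \<partial>lebesgue_on {0..T}) = c * min T \<theta>" .
qed

section \<open>The steering control\<close>

text \<open>Only the uniform flow bound on \<open>[0,1]\<close> is assumed. Bounds on the longer
  interval enter through \<open>\<omega>_energy\<close>, so that \<open>\<Theta>\<close> and
  \<open>N\<close> can be chosen later.\<close>

locale steering =
  fixes n :: "nat \<Rightarrow> nat" and A :: "nat \<Rightarrow> real mat" and x0 :: "nat \<Rightarrow> real vec"
    and K \<Theta> :: real and N :: nat
  assumes A: "\<And>i. A i \<in> carrier_mat (n i) (n i)"
    and x0: "x0 \<in> ell2 n"
    and K: "\<And>i t. 0 \<le> t \<Longrightarrow> t \<le> 1 \<Longrightarrow> enorm (mat_exp (t \<cdot>\<^sub>m A i) *\<^sub>v x0 i) \<le> K * enorm (x0 i)"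
    and \<Theta>: "\<Theta> \<ge> 1"
begin

text \<open>The steering duration of a component: long for the finitely many components that must be
  steered cheaply, one for the tail, where the flow bound is uniform.\<close>

definition \<theta> :: "nat \<Rightarrow> real" where
  "\<theta> i = (if i < N then \<Theta> else 1)"

definition flow :: "real \<Rightarrow> nat \<Rightarrow> real vec" where
  "flow t i = mat_exp (t \<cdot>\<^sub>m A i) *\<^sub>v x0 i"

text \<open>
  Cancelling the initial value at constant relative speed: \<open>e\<^bsup>(t - s)A\<^esup>\<close> carries the control value at
  time \<open>s\<close> to \<open>- e\<^bsup>tA\<^esup> x0 / \<theta>\<close>, independently of \<open>s\<close>.
\<close>

definition \<omega> :: "real \<Rightarrow> nat \<Rightarrow> real vec" where
  "\<omega> t i = (if t \<le> \<theta> i then - (1 / \<theta> i) else 0) \<cdot>\<^sub>v flow t i"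

definition trajectory :: "real \<Rightarrow> nat \<Rightarrow> real vec" where
  "trajectory t i = (1 - min t (\<theta> i) / \<theta> i) \<cdot>\<^sub>v flow t i"

lemma \<theta>_bounds: "1 \<le> \<theta> i" "\<theta> i \<le> \<Theta>" "0 < \<theta> i"
  using \<Theta> by (auto simp: \<theta>_def)

lemma x0_carrier: "x0 i \<in> carrier_vec (n i)"
  using x0 by (simp add: ell2_def)

lemma flow_carrier: "flow t i \<in> carrier_vec (n i)"
  unfolding flow_def using A x0_carrier by (intro mult_mat_vec_carrier[of _ _ "n i"]) auto

lemma dim_flow [simp]: "dim_vec (flow t i) = n i"
  using flow_carrier by (rule carrier_vecD)

lemma \<omega>_carrier: "\<omega> t i \<in> carrier_vec (n i)"
  unfolding \<omega>_def using flow_carrier by simp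

text \<open>From index \<open>N\<close> on the control is switched off after time one, so the flow
  matters only on \<open>[0,1]\<close>, where \<open>K\<close> bounds it. The maximum with
  \<open>0\<close> covers the switched-off control, as no sign of \<open>K\<close> is
  assumed.\<close>

lemma \<omega>_ell2:
  assumes "0 \<le> t"
  shows "\<omega> t \<in> ell2 n"
proof (rule ell2_eventually_le[OF x0 \<omega>_carrier, where N = N and K = "max 0 K"])
  fix i assume "N \<le> i"
  then show "enorm (\<omega> t i) \<le> max 0 K * enorm (x0 i)"
    using K[of t i] assms by (auto simp: \<omega>_def flow_def \<theta>_def max_def intro: order_trans[OF _ mult_nonpos_nonneg])
qed

lemma trajectory_ell2:
  assumes "0 \<le> t"
  shows "trajectory t \<in> ell2 n"
proof (rule ell2_eventually_le[OF x0, where N = N and K = "max 0 K"])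
  show "trajectory t i \<in> carrier_vec (n i)" for i
    unfolding trajectory_def using flow_carrier by simp
  fix i assume "N \<le> i"
  then have \<theta>: "\<theta> i = 1" by (simp add: \<theta>_def)
  show "enorm (trajectory t i) \<le> max 0 K * enorm (x0 i)"
  proof (cases "t \<le> 1")
    case True
    have "enorm (trajectory t i) \<le> enorm (flow t i)"
      using True assms by (simp add: trajectory_def \<theta> mult_left_le_one_le)
    also have "\<dots> \<le> K * enorm (x0 i)" unfolding flow_def by (rule K[OF assms True])
    also have "\<dots> \<le> max 0 K * enorm (x0 i)" by (intro mult_right_mono) auto
    finally show ?thesis .
  qed (simp add: trajectory_def \<theta>)
qed

text \<open>No duration exceeds \<open>\<Theta>\<close>, so every component has been cancelled by
  this common time.\<close>

lemma trajectory_end: "trajectory \<Theta> i = 0\<^sub>v (n i)"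
  using \<theta>_bounds[of i] by (intro eq_vecI) (auto simp: trajectory_def min_absorb2)

text \<open>A step function in time multiplied by a coordinate of the flow, which is
  continuous.\<close>

lemma \<omega>_measurable:
  assumes "k < n i"
  shows "(\<lambda>t. \<omega> t i $ k) \<in> borel_measurable (lebesgue_on {0..T})"
proof -
  have "continuous_on {0..T} (\<lambda>t. \<Sum>l<n i. mat_exp (t \<cdot>\<^sub>m A i) $$ (k, l) * x0 i $ l)"
    using assms by (intro continuous_intros continuous_on_mat_exp[OF A]) auto
  then have "(\<lambda>t. \<Sum>l<n i. mat_exp (t \<cdot>\<^sub>m A i) $$ (k, l) * x0 i $ l) \<in> borel_measurable (lebesgue_on {0..T})"
    by (rule continuous_imp_measurable_on_sets_lebesgue) simp
  moreover have "\<omega> t i $ k = (if t \<le> \<theta> i then - (1 / \<theta> i) else 0) *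
      (\<Sum>l<n i. mat_exp (t \<cdot>\<^sub>m A i) $$ (k, l) * x0 i $ l)" for t
  proof -
    have "mat_exp (t \<cdot>\<^sub>m A i) \<in> carrier_mat (n i) (n i)" using A by simp
    from mult_mat_vec_index[OF this x0_carrier assms] show ?thesis
      using assms by (simp add: \<omega>_def flip: flow_def)
  qed
  ultimately show ?thesis
    using borel_measurable_times[OF borel_measurable_step] by simp
qed

text \<open>A control of size at most \<open>b / \<theta> i\<close> during a time
  \<open>\<theta> i\<close> costs at most \<open>b^2 / \<theta> i\<close>: slow steering is cheap as
  long as the flow stays bounded.\<close>

lemma \<omega>_energy:
  assumes b: "\<And>t. 0 \<le> t \<Longrightarrow> t \<le> \<theta> i \<Longrightarrow> enorm (flow t i) \<le> b" and T: "\<Theta> \<le> T"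
  shows "(\<integral>\<^sup>+ s. ennreal ((enorm (\<omega> s i))\<^sup>2) \<partial>lebesgue_on {0..T}) \<le> ennreal (b\<^sup>2 / \<theta> i)"
proof -
  have "(\<integral>\<^sup>+ s. ennreal ((enorm (\<omega> s i))\<^sup>2) \<partial>lebesgue_on {0..T}) \<le>
      (\<integral>\<^sup>+ s. ennreal ((b / \<theta> i)\<^sup>2) * indicator {0..\<theta> i} s \<partial>lebesgue_on {0..T})"
  proof (rule nn_integral_mono)
    fix s assume "s \<in> space (lebesgue_on {0..T})"
    then have s: "0 \<le> s" by simp
    show "ennreal ((enorm (\<omega> s i))\<^sup>2) \<le> ennreal ((b / \<theta> i)\<^sup>2) * indicator {0..\<theta> i} s"
    proof (cases "s \<le> \<theta> i")
      case True
      have "enorm (\<omega> s i) \<le> b / \<theta> i"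
        using True b[OF s] \<theta>_bounds[of i] by (simp add: \<omega>_def divide_right_mono)
      then have "(enorm (\<omega> s i))\<^sup>2 \<le> (b / \<theta> i)\<^sup>2" by (intro power_mono) auto
      then show ?thesis using True s by (simp add: ennreal_leI)
    qed (simp add: \<omega>_def)
  qed
  also have "\<dots> = ennreal ((b / \<theta> i)\<^sup>2) * emeasure (lebesgue_on {0..T}) {0..\<theta> i}"
    using \<theta>_bounds[of i] T by (intro nn_integral_cmult_indicator) (auto simp: sets_restrict_space_iff)
  also have "emeasure (lebesgue_on {0..T}) {0..\<theta> i} = ennreal (\<theta> i)"
    using \<theta>_bounds[of i] T by (subst emeasure_restrict_space) auto
  also have "ennreal ((b / \<theta> i)\<^sup>2) * ennreal (\<theta> i) = ennreal (b\<^sup>2 / \<theta> i)"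
    using \<theta>_bounds[of i] by (simp flip: ennreal_mult) (simp add: field_simps power2_eq_square)
  finally show ?thesis .
qed

text \<open>By the semigroup law the integrand of the solution formula is a scalar step function of
  \<open>s\<close> times a vector independent of \<open>s\<close>.\<close>

lemma mat_exp_\<omega>:
  "mat_exp ((t - s) \<cdot>\<^sub>m A i) *\<^sub>v \<omega> s i = (if s \<le> \<theta> i then - (1 / \<theta> i) else 0) \<cdot>\<^sub>v flow t i"
proof -
  have "mat_exp ((t - s) \<cdot>\<^sub>m A i) \<in> carrier_mat (n i) (n i)" using A by simp
  from mult_mat_vec[OF this flow_carrier] show ?thesis
    unfolding \<omega>_def flow_def using mat_exp_add_mult_vec[OF A x0_carrier, of "t - s" i s] by simp
qed

lemma trajectory_is_solution:
  assumes v: "\<And>t i. t \<in> {0..T} \<Longrightarrow> v t i \<in> carrier_vec (n i)"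
  shows "is_solution n A T x0 (\<lambda>t i. v t i + \<omega> t i) v trajectory"
  unfolding is_solution_def
proof (intro ballI conjI allI)
  fix t i assume t: "t \<in> {0..T}"
  then show "trajectory t \<in> ell2 n" by (intro trajectory_ell2) simp
  have "(\<integral>s. (mat_exp ((t - s) \<cdot>\<^sub>m A i) *\<^sub>v (v s i + \<omega> s i - v s i)) $ k \<partial>lebesgue_on {0..t}) =
      - (min t (\<theta> i) / \<theta> i) * flow t i $ k" if k: "k < n i" for k
  proof -
    have "(\<integral>s. (mat_exp ((t - s) \<cdot>\<^sub>m A i) *\<^sub>v (v s i + \<omega> s i - v s i)) $ k \<partial>lebesgue_on {0..t}) =
        (\<integral>s. (if s \<le> \<theta> i then - (1 / \<theta> i) else 0) * flow t i $ k \<partial>lebesgue_on {0..t})"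
    proof (rule Bochner_Integration.integral_cong[OF refl])
      fix s assume "s \<in> space (lebesgue_on {0..t})"
      then have "s \<in> {0..T}" using t by auto
      \<comment> \<open>Cancelling the evader's control requires matching dimensions, which are
        guaranteed on \<open>[0,T]\<close>.\<close>
      then have "v s i + \<omega> s i - v s i = \<omega> s i"
        using v[of s i] \<omega>_carrier[of s i] by (intro eq_vecI) auto
      then show "(mat_exp ((t - s) \<cdot>\<^sub>m A i) *\<^sub>v (v s i + \<omega> s i - v s i)) $ k =
          (if s \<le> \<theta> i then - (1 / \<theta> i) else 0) * flow t i $ k"
        using k by (simp add: mat_exp_\<omega>)
    qed
    also have "\<dots> = - (1 / \<theta> i) * min t (\<theta> i) * flow t i $ k"
      using integral_step[of t "\<theta> i" "- (1 / \<theta> i)"] t \<theta>_bounds[of i] by simp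
    finally show ?thesis by simp
  qed
  then show "trajectory t i = mat_exp (t \<cdot>\<^sub>m A i) *\<^sub>v x0 i + vec (n i) (\<lambda>k. \<integral>s.
      (mat_exp ((t - s) \<cdot>\<^sub>m A i) *\<^sub>v (v s i + \<omega> s i - v s i)) $ k \<partial>lebesgue_on {0..t})"
    using flow_carrier[of t i] unfolding flow_def[symmetric] trajectory_def
    by (intro eq_vecI) (auto simp: algebra_simps)
qed

end

text \<open>The budget \<open>\<delta>^2\<close> is split in half between tail and head.
  \<open>N\<close> is chosen first, for the tail; only then is \<open>\<Theta>\<close> chosen for
  the head, since the bounds \<open>M i\<close> are not uniform in \<open>i\<close>. Neither depends
  on the horizon \<open>T\<close>.\<close>

lemma steering_exists:
  assumes A: "\<And>i. A i \<in> carrier_mat (n i) (n i)" and x0: "x0 \<in> ell2 n" and \<delta>: "\<delta> > 0"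
    and K: "\<And>i t. 0 \<le> t \<Longrightarrow> t \<le> 1 \<Longrightarrow> enorm (mat_exp (t \<cdot>\<^sub>m A i) *\<^sub>v x0 i) \<le> K * enorm (x0 i)"
    and bounded: "\<And>i. \<exists>M. \<forall>t\<ge>0. enorm (mat_exp (t \<cdot>\<^sub>m A i) *\<^sub>v x0 i) \<le> M"
  obtains \<Theta> N where "steering n A x0 K \<Theta>" and "\<And>T. T \<ge> \<Theta> \<Longrightarrow> steering.\<omega> A x0 \<Theta> N \<in> controls n T \<delta>"
proof -
  obtain M where M: "\<And>i t. 0 \<le> t \<Longrightarrow> enorm (mat_exp (t \<cdot>\<^sub>m A i) *\<^sub>v x0 i) \<le> M i"
    using bounded by metis
  have summ: "summable (\<lambda>i. (K * enorm (x0 i))\<^sup>2)"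
    using x0 by (auto simp: ell2_def power_mult_distrib intro: summable_mult)
  then obtain N where N: "norm (\<Sum>i. (K * enorm (x0 (i + N)))\<^sup>2) < \<delta>\<^sup>2 / 2"
    using suminf_exist_split[of "\<delta>\<^sup>2 / 2" "\<lambda>i. (K * enorm (x0 i))\<^sup>2"] \<delta> by auto
  \<comment> \<open>The second entry bounds the head energy, the sum of
    \<open>(M i)^2 / \<Theta>\<close> over \<open>i < N\<close>, by \<open>\<delta>^2 / 2\<close>;
    the first secures the locale assumption on \<open>\<Theta>\<close>.\<close>
  define \<Theta> where "\<Theta> = max 1 (2 * (\<Sum>i<N. (M i)\<^sup>2) / \<delta>\<^sup>2)"
  have large: "\<Theta> \<ge> 1" "\<Theta> \<ge> 2 * (\<Sum>i<N. (M i)\<^sup>2) / \<delta>\<^sup>2" by (auto simp: \<Theta>_def)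
  interpret steering n A x0 K \<Theta> N
    using A x0 K large(1) by unfold_locales
  have head: "(\<Sum>i<N. (M i)\<^sup>2 / \<Theta>) \<le> \<delta>\<^sup>2 / 2"
  proof -
    have "2 * (\<Sum>i<N. (M i)\<^sup>2) \<le> \<Theta> * \<delta>\<^sup>2"
      using large(2) \<delta> by (subst (asm) pos_divide_le_eq) auto
    then show ?thesis
      unfolding sum_divide_distrib[symmetric] using large(1) by (subst pos_divide_le_eq) (auto simp: ac_simps)
  qed
  \<comment> \<open>A flow bound on the steering interval of each component; from index
    \<open>N\<close> on this interval is \<open>[0,1]\<close>, so \<open>K\<close> applies.\<close>
  define b where "b i = (if i < N then M i else K * enorm (x0 i))" for i
  have b: "enorm (flow t i) \<le> b i" if "0 \<le> t" "t \<le> \<theta> i" for t i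
    using that M[of t i] K[of t i] by (auto simp: flow_def b_def \<theta>_def split: if_splits)
  have tail: "(b (i + N))\<^sup>2 / \<theta> (i + N) = (K * enorm (x0 (i + N)))\<^sup>2" for i
    by (simp add: b_def \<theta>_def)
  have "summable (\<lambda>i. (b (i + N))\<^sup>2 / \<theta> (i + N))"
    unfolding tail by (rule summable_ignore_initial_segment[OF summ])
  then have bsumm: "summable (\<lambda>i. (b i)\<^sup>2 / \<theta> i)"
    by (rule summable_iff_shift[THEN iffD1])
  have "(\<Sum>i. (b i)\<^sup>2 / \<theta> i) = (\<Sum>i. (K * enorm (x0 (i + N)))\<^sup>2) + (\<Sum>i<N. (b i)\<^sup>2 / \<theta> i)"
    using suminf_split_initial_segment[OF bsumm, of N] by (simp add: tail)
  also have "(\<Sum>i<N. (b i)\<^sup>2 / \<theta> i) = (\<Sum>i<N. (M i)\<^sup>2 / \<Theta>)"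
    by (intro sum.cong) (auto simp: b_def \<theta>_def)
  finally have total: "(\<Sum>i. (b i)\<^sup>2 / \<theta> i) \<le> \<delta>\<^sup>2"
    using head N by (simp add: abs_less_iff)
  have "\<omega> \<in> controls n T \<delta>" if T: "T \<ge> \<Theta>" for T
  proof -
    have "(\<Sum>i. \<integral>\<^sup>+ s. ennreal ((enorm (\<omega> s i))\<^sup>2) \<partial>lebesgue_on {0..T}) \<le> (\<Sum>i. ennreal ((b i)\<^sup>2 / \<theta> i))"
      using b T by (intro suminf_le \<omega>_energy) auto
    also have "\<dots> = ennreal (\<Sum>i. (b i)\<^sup>2 / \<theta> i)"
      using bsumm \<theta>_bounds by (intro suminf_ennreal2) (auto simp: less_imp_le)
    also have "\<dots> \<le> ennreal (\<delta>\<^sup>2)" using total by (rule ennreal_leI)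
    finally show ?thesis
      using \<omega>_ell2 \<omega>_measurable by (auto simp: controls_def)
  qed
  with that steering_axioms show thesis by blast
qed

theorem theorem3:
  fixes d :: nat and n :: "nat \<Rightarrow> nat" and A :: "nat \<Rightarrow> real mat"
    and x0 :: "nat \<Rightarrow> real vec" and \<rho> \<sigma> :: real
  assumes "d \<ge> 2"
    and "\<And>i. 2 \<le> n i \<and> n i \<le> d"
    and "\<And>i. A i \<in> carrier_mat (n i) (n i)"
    and "uniformly_normalizable A"
    and "\<And>i z. eigenvalue (map_mat complex_of_real (A i)) z \<Longrightarrow> Re z < 0"
    and "\<rho> > 0" and "\<sigma> > 0" and "\<rho> > \<sigma>"
    and "x0 \<in> ell2 n"
  shows "\<exists>T0>0. \<forall>T\<ge>T0. \<forall>v\<in>controls n T \<sigma>.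
    \<exists>U \<theta>1. pursuer_strategy n T \<rho> \<sigma> U \<and> 0 < \<theta>1 \<and> \<theta>1 \<le> T \<and>
      (\<exists>x. is_solution n A T x0 (\<lambda>t. U t (v t)) v x \<and>
        (\<exists>\<tau>. 0 \<le> \<tau> \<and> \<tau> \<le> \<theta>1 \<and> (\<forall>i. x \<tau> i = 0\<^sub>v (n i))))"
proof -
  note A = assms(3)
  obtain P Q :: "nat \<Rightarrow> complex mat" and C :: real where C: "C \<ge> 1"
    and nf: "\<And>i. op_norm (P i) * op_norm (Q i) \<le> C \<and> (\<exists>n_as. 0 \<notin> fst ` set n_as \<and>
      similar_mat_wit (jordan_matrix n_as) (map_mat complex_of_real (A i)) (P i) (Q i))"
    using assms(4) unfolding uniformly_normalizable_def by blast
  have x0: "x0 i \<in> carrier_vec (n i)" for i using assms(9) by (simp add: ell2_def)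
  have bounds: "(\<forall>t. 0 \<le> t \<and> t \<le> 1 \<longrightarrow>
        enorm (mat_exp (t \<cdot>\<^sub>m A i) *\<^sub>v x0 i) \<le> C * (real d)\<^sup>2 * enorm (x0 i)) \<and>
      (\<exists>M. \<forall>t\<ge>0. enorm (mat_exp (t \<cdot>\<^sub>m A i) *\<^sub>v x0 i) \<le> M)" for i
  proof -
    obtain n_as where n_as: "0 \<notin> fst ` set n_as"
      and wit: "similar_mat_wit (jordan_matrix n_as) (map_mat complex_of_real (A i)) (P i) (Q i)"
      using nf[of i] by blast
    have cA: "map_mat complex_of_real (A i) \<in> carrier_mat (n i) (n i)" using A[of i] by simp
    have "jordan_nf (map_mat complex_of_real (A i)) n_as"
      using n_as similar_mat_wit_sym[OF wit] unfolding jordan_nf_def similar_mat_def by blast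
    then have neg: "Re a < 0" if "a \<in> snd ` set n_as" for a
      using jordan_nf_eigenvalue[OF cA _ that] assms(5) by blast
    \<comment> \<open>The constants \<open>C\<close> and \<open>d\<close> remove the dependence on
      \<open>i\<close>, which gives the uniform flow bound with \<open>K = C * d^2\<close>.\<close>
    have PQ: "op_norm (P i) * op_norm (Q i) * (real (n i))\<^sup>2 * enorm (x0 i) \<le> C * (real d)\<^sup>2 * enorm (x0 i)"
      using nf[of i] assms(2)[of i] C by (intro mult_right_mono mult_mono power_mono) auto
    show ?thesis
      using mat_exp_bounds[OF A wit neg x0] PQ by (meson order_trans)
  qed
  have \<delta>: "\<rho> - \<sigma> > 0" using assms(8) by simp
  obtain \<Theta> N where steer: "steering n A x0 (C * (real d)\<^sup>2) \<Theta>"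
    and ctrl: "\<And>T. T \<ge> \<Theta> \<Longrightarrow> steering.\<omega> A x0 \<Theta> N \<in> controls n T (\<rho> - \<sigma>)"
    by (rule steering_exists[OF A assms(9) \<delta>, of "C * (real d)\<^sup>2"]) (use bounds in blast)+
  interpret steering n A x0 "C * (real d)\<^sup>2" \<Theta> N by (rule steer)
  \<comment> \<open>The strategy copies the evader and spends the surplus
    \<open>\<rho> - \<sigma>\<close> on steering; it depends neither on the evader's control
    function nor on \<open>T\<close>.\<close>
  define U where "U t y k = y k + \<omega> t k" for t and y :: "nat \<Rightarrow> real vec" and k
  show ?thesis
  \<comment> \<open>\<open>\<Theta>\<close> is the threshold for the horizon and serves again as
    completion time for every evader control.\<close>
  proof (intro exI[of _ \<Theta>] conjI allI impI ballI)
    fix T v assume T: "\<Theta> \<le> T" and v: "v \<in> controls n T \<sigma>"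
    have "(\<lambda>t. U t (v t)) \<in> controls n T \<rho>" if "v \<in> controls n T \<sigma>" for v
      using controls_add[OF that ctrl[OF T] assms(7) \<delta>] by (simp add: U_def[abs_def])
    then have strategy: "pursuer_strategy n T \<rho> \<sigma> U"
      unfolding pursuer_strategy_def using ctrl[OF T] ell2_add[OF _ \<omega>_ell2] by (auto simp: U_def[abs_def])
    have "is_solution n A T x0 (\<lambda>t. U t (v t)) v trajectory"
      unfolding U_def[abs_def] using v by (intro trajectory_is_solution) (auto simp: controls_def ell2_def)
    with strategy T \<Theta> trajectory_end
    show "\<exists>U \<theta>1. pursuer_strategy n T \<rho> \<sigma> U \<and> 0 < \<theta>1 \<and> \<theta>1 \<le> T \<and>
      (\<exists>x. is_solution n A T x0 (\<lambda>t. U t (v t)) v x \<and>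
        (\<exists>\<tau>. 0 \<le> \<tau> \<and> \<tau> \<le> \<theta>1 \<and> (\<forall>i. x \<tau> i = 0\<^sub>v (n i))))"
      by (intro exI[of _ U] exI[of _ \<Theta>] conjI exI[of _ trajectory]) auto
  qed (use \<Theta> in simp)
qed

end
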